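(* $R^{cl}(\omega+2,3)\geq\omega^2\cdot 2+\omega+2$.
   Context: All arithmetic operations on ordinals are in the ordinal sense. Every ordinal is identified with the set of smaller ordinals and carries the order topology; subsets carry the subspace topology. A set $X$ of ordinals is order-homeomorphic to an ordinal $\alpha$ (a closed copy of $\alpha$) if there is a bijection $X\to\alpha$ that is both an order-isomorphism and a homeomorphism; equivalently, $X$ is order-isomorphic to $\alpha$ and closed in its supremum. $[X]^2$ is the set of $2$-element subsets of $X$. $R^{cl}(\alpha,k)$ is the least ordinal $\beta$ such that for every coloring $c:[\beta]^2\to\{\text{red},\text{blue}\}$ either there is $X\subseteq\beta$ order-homeomorphic to $\alpha$ with all elements of $[X]^2$ red, or there is a $k$-element $Y\subseteq\beta$ with all elements of $[Y]^2$ blue. *)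

theory Defs
  imports
    "HOL-Analysis.Abstract_Topology"
    "HOL-Library.Ramsey"
begin

unbundle cardinal_syntax

text \<open>
  An ordinal is represented by a well-order relation, taken up to isomorphism and compared with
  others by \<open>\<le>o\<close> and \<open><o\<close>; the set of smaller ordinals is the field of the relation.
\<close>

text \<open>Ordinal arithmetic. In the product the second component is the more significant one.\<close>

definition ord_sum :: "'a rel \<Rightarrow> 'b rel \<Rightarrow> ('a + 'b) rel"  (infixl \<open>\<oplus>o\<close> 65)
  where "r \<oplus>o s =
    {(Inl a, Inl a') | a a'. (a, a') \<in> r} \<union>
    {(Inr b, Inr b') | b b'. (b, b') \<in> s} \<union>
    {(Inl a, Inr b) | a b. a \<in> Field r \<and> b \<in> Field s}"

definition ord_prod :: "'a rel \<Rightarrow> 'b rel \<Rightarrow> ('a \<times> 'b) rel"  (infixl \<open>\<otimes>o\<close> 70)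
  where "r \<otimes>o s =
    {((a, b), (a', b')) | a b a' b'.
      (a \<in> Field r \<and> a' \<in> Field r \<and> (b, b') \<in> s \<and> b \<noteq> b') \<or>
      ((a, a') \<in> r \<and> b = b' \<and> b \<in> Field s)}"

abbreviation ord_omega :: "nat rel"  (\<open>\<omega>\<close>)
  where "\<omega> \<equiv> natLeq"

abbreviation ord_of_nat :: "nat \<Rightarrow> nat rel"
  where "ord_of_nat n \<equiv> natLeq_on n"

text \<open>
  The order topology is generated by the open rays; the whole field is added to the generators
  so that it is the underlying space also when it has at most one element.
\<close>

definition order_top :: "'a rel \<Rightarrow> 'a topology"
  where "order_top r =
    topology_generated_by (insert (Field r) (underS r ` Field r \<union> aboveS r ` Field r))"

definition closed_copy :: "'a rel \<Rightarrow> 'a set \<Rightarrow> 'b rel \<Rightarrow> bool"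
  where "closed_copy \<beta> X \<alpha> \<longleftrightarrow> X \<subseteq> Field \<beta> \<and>
    (\<exists>f. iso (Restr \<beta> X) \<alpha> f \<and>
         homeomorphic_map (subtopology (order_top \<beta>) X) (order_top \<alpha>) f)"

datatype color = Red | Blue

text \<open>Colorings are total functions on sets; only their values on 2-element subsets of the field
  matter.\<close>

definition closed_arrow :: "'a rel \<Rightarrow> 'b rel \<Rightarrow> nat \<Rightarrow> bool"
  where "closed_arrow \<beta> \<alpha> k \<longleftrightarrow>
    (\<forall>c :: 'a set \<Rightarrow> color.
      (\<exists>X. closed_copy \<beta> X \<alpha> \<and> (\<forall>e \<in> [X]\<^bsup>2\<^esup>. c e = Red)) \<or>
      (\<exists>Y \<in> [Field \<beta>]\<^bsup>k\<^esup>. \<forall>e \<in> [Y]\<^bsup>2\<^esup>. c e = Blue))"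

text \<open>
  \<open>\<rho>\<close> is (a representative of) \<open>R\<^sup>c\<^sup>l(\<alpha>, k)\<close>. It is enough to let the smaller ordinals \<open>\<beta>\<close> range over
  relations on the type of \<open>\<rho>\<close>: every ordinal below \<open>\<rho>\<close> is isomorphic to an initial segment of \<open>\<rho>\<close>.
\<close>

definition is_closed_Ramsey :: "'b rel \<Rightarrow> nat \<Rightarrow> 'a rel \<Rightarrow> bool"
  where "is_closed_Ramsey \<alpha> k \<rho> \<longleftrightarrow>
    Well_order \<rho> \<and> closed_arrow \<rho> \<alpha> k \<and>
    (\<forall>\<beta> :: 'a rel. \<beta> <o \<rho> \<longrightarrow> \<not> closed_arrow \<beta> \<alpha> k)"

end

theory Submission
  imports Defs
begin

text \<open>
  Write \<open>\<delta> = \<omega>\<^sup>2\<cdot>2 + \<omega> + 1\<close>. Some coloring of the pairs below \<open>\<delta>\<close> has neither a red closed copy of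
  \<open>\<omega> + 2\<close> nor a blue triangle; every ordinal below \<open>\<omega>\<^sup>2\<cdot>2 + \<omega> + 2\<close> is an initial segment of \<open>\<delta>\<close>
  and inherits the coloring.

  The blue graph is a blow-up of the pentagon, hence triangle-free: cut \<open>\<delta>\<close> into five classes
  \<^item> \<open>0\<close>: \<open>0\<close> and the successors below \<open>\<omega>\<^sup>2\<close>,
  \<^item> \<open>1\<close>: the limits below \<open>\<omega>\<^sup>2\<close>,
  \<^item> \<open>2\<close>: the point \<open>\<omega>\<^sup>2\<close>,
  \<^item> \<open>3\<close>: the limits strictly between \<open>\<omega>\<^sup>2\<close> and \<open>\<omega>\<^sup>2\<cdot>2\<close>, and everything above \<open>\<omega>\<^sup>2\<cdot>2\<close>,
  \<^item> \<open>4\<close>: the successors between \<open>\<omega>\<^sup>2\<close> and \<open>\<omega>\<^sup>2\<cdot>2\<close>, and \<open>\<omega>\<^sup>2\<cdot>2\<close> itself,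

  and make a pair blue iff its classes are cyclically adjacent. A red closed copy of \<open>\<omega> + 2\<close> would
  give points \<open>y < z\<close> such that red points of it, also red to \<open>y\<close> and \<open>z\<close>, accumulate at \<open>y\<close> from
  below. No limit \<open>y\<close> allows this:
  \<^item> A limit \<open>y\<close> that is not a multiple of \<open>\<omega>\<^sup>2\<close> is blue to all successors in the
    \<open>\<omega>\<close>-block just below it, which are in class \<open>0\<close> or \<open>4\<close>. The only exception is the limit
    above \<open>\<omega>\<^sup>2\<cdot>2\<close>, but that is the largest point, and there is no \<open>z\<close>.
  \<^item> If \<open>y = \<omega>\<^sup>2\<close>, then either \<open>z\<close> is in class \<open>3\<close>, and blue to \<open>y\<close>; or \<open>z\<close> is in class \<open>4\<close>, and
    then every point below \<open>y\<close> is blue to \<open>y\<close> (class \<open>1\<close>) or to \<open>z\<close> (class \<open>0\<close>).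
  \<^item> If \<open>y = \<omega>\<^sup>2\<cdot>2\<close>, then every later \<open>z\<close> is blue to \<open>y\<close>.

  This case distinction is \<open>pentagon_class_hits_accumulation\<close>. Topology enters only through
  \<open>closed_copy_omega_plus_2_accumulates\<close>, which finds \<open>y\<close> and \<open>z\<close> in a closed copy, and
  \<open>accumulates_below_image\<close> carries them into \<open>\<delta>\<close>.
\<close>

section \<open>Sums and products of well-orders\<close>

lemma ord_sum_iff:
  "(Inl a, Inl a') \<in> r \<oplus>o s \<longleftrightarrow> (a, a') \<in> r"
  "(Inr b, Inr b') \<in> r \<oplus>o s \<longleftrightarrow> (b, b') \<in> s"
  "(Inl a, Inr b) \<in> r \<oplus>o s \<longleftrightarrow> a \<in> Field r \<and> b \<in> Field s"
  "(Inr b, Inl a) \<notin> r \<oplus>o s"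
  by (auto simp: ord_sum_def)

lemma ord_prod_iff:
  "((a, b), (a', b')) \<in> r \<otimes>o s \<longleftrightarrow>
    a \<in> Field r \<and> a' \<in> Field r \<and> (b, b') \<in> s \<and> b \<noteq> b' \<or> (a, a') \<in> r \<and> b = b' \<and> b \<in> Field s"
  by (auto simp: ord_prod_def)

lemma Field_ord_sum: "Field (r \<oplus>o s) = Inl ` Field r \<union> Inr ` Field s"
proof
  show "Field (r \<oplus>o s) \<subseteq> Inl ` Field r \<union> Inr ` Field s"
    unfolding ord_sum_def by (auto simp: Field_def)
  show "Inl ` Field r \<union> Inr ` Field s \<subseteq> Field (r \<oplus>o s)"
    unfolding Field_def[of r] Field_def[of s]
    by (blast intro: FieldI1 FieldI2 ord_sum_iff(1,2)[THEN iffD2])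
qed

lemma Field_ord_prod:
  assumes "Refl r" "Refl s"
  shows "Field (r \<otimes>o s) = Field r \<times> Field s"
proof
  show "Field (r \<otimes>o s) \<subseteq> Field r \<times> Field s"
    unfolding ord_prod_def by (auto simp: Field_def)
  show "Field r \<times> Field s \<subseteq> Field (r \<otimes>o s)"
  proof clarify
    fix a b assume "a \<in> Field r" "b \<in> Field s"
    hence "((a, b), (a, b)) \<in> r \<otimes>o s"
      using assms unfolding ord_prod_def refl_on_def by auto
    thus "(a, b) \<in> Field (r \<otimes>o s)" by (rule FieldI1)
  qed
qed

lemma Well_order_ord_sum:
  assumes r: "Well_order r" and s: "Well_order s"
  shows "Well_order (r \<oplus>o s)"
proof -
  note wo = r[unfolded order_on_defs] s[unfolded order_on_defs]
  have "Refl (r \<oplus>o s)"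
    using wo unfolding refl_on_def Field_ord_sum by (auto simp: ord_sum_def)
  moreover have "trans (r \<oplus>o s)"
  proof (rule transI)
    fix x y z assume "(x, y) \<in> r \<oplus>o s" "(y, z) \<in> r \<oplus>o s"
    moreover have "trans r" "trans s" using wo by auto
    ultimately show "(x, z) \<in> r \<oplus>o s"
      by (cases x; cases y; cases z) (auto simp: ord_sum_iff intro: FieldI1 FieldI2 dest: transD)
  qed
  moreover have "antisym (r \<oplus>o s)"
    using wo unfolding antisym_def by (auto simp: ord_sum_def)
  moreover have "Total (r \<oplus>o s)"
    using wo unfolding total_on_def Field_ord_sum by (auto simp: ord_sum_iff; blast)
  moreover have "wf (r \<oplus>o s - Id)"
  proof (rule wfUNIVI)
    fix P and x :: "'a + 'b"
    assume "\<forall>x. (\<forall>y. (y, x) \<in> r \<oplus>o s - Id \<longrightarrow> P y) \<longrightarrow> P x"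
    hence step: "P x" if "\<And>y. (y, x) \<in> r \<oplus>o s - Id \<Longrightarrow> P y" for x using that by blast
    have l: "P (Inl a)" for a
    proof (induction a rule: wf_induct_rule[OF conjunct2[OF wo(1)]])
      case (1 a)
      show ?case by (rule step) (use 1 in \<open>auto simp: ord_sum_def\<close>)
    qed
    have "P (Inr b)" for b
    proof (induction b rule: wf_induct_rule[OF conjunct2[OF wo(2)]])
      case (1 b)
      show ?case by (rule step) (use 1 l in \<open>auto simp: ord_sum_def\<close>)
    qed
    with l show "P x" by (cases x) auto
  qed
  ultimately show ?thesis unfolding order_on_defs by (auto simp: Field_def)
qed

lemma Well_order_ord_prod:
  assumes r: "Well_order r" and s: "Well_order s"
  shows "Well_order (r \<otimes>o s)"
proof -
  note wo = r[unfolded order_on_defs] s[unfolded order_on_defs]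
  note field = Field_ord_prod[of r s]
  have refl: "Refl r" "Refl s" using wo by auto
  have "Refl (r \<otimes>o s)"
    using refl unfolding refl_on_def field[OF refl] by (auto simp: ord_prod_def)
  moreover have "trans (r \<otimes>o s)"
  proof (rule transI)
    fix x y z assume "(x, y) \<in> r \<otimes>o s" "(y, z) \<in> r \<otimes>o s"
    moreover have "trans r" "trans s" "antisym s" using wo by auto
    ultimately show "(x, z) \<in> r \<otimes>o s"
      unfolding ord_prod_def
      by (auto intro: FieldI1 FieldI2 dest: transD antisymD)
  qed
  moreover have "antisym (r \<otimes>o s)"
    using wo unfolding antisym_def by (auto simp: ord_prod_def)
  moreover have "Total (r \<otimes>o s)"
    using wo unfolding total_on_def field[OF refl] by (auto simp: ord_prod_def refl_on_def)
  moreover have "wf (r \<otimes>o s - Id)"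
  proof (rule wf_subset)
    show "wf (inv_image ((s - Id) <*lex*> (r - Id)) prod.swap)"
      using wo by (intro wf_inv_image wf_lex_prod) auto
    show "r \<otimes>o s - Id \<subseteq> inv_image ((s - Id) <*lex*> (r - Id)) prod.swap"
      by (auto simp: ord_prod_def inv_image_def)
  qed
  ultimately show ?thesis unfolding order_on_defs by (auto simp: Field_def)
qed

section \<open>Closed copies of \<open>\<omega> + 2\<close>\<close>

text \<open>
  The topological content of being a closed copy: in \<open>\<omega> + 2\<close> the point \<open>\<omega>\<close> is not isolated. The
  statement about all large \<open>n\<close> is what survives finite intersections of rays.
\<close>

lemma open_nhd_of_omega_contains_tail:
  assumes "openin (order_top (\<omega> \<oplus>o ord_of_nat 2)) U" and "Inr 0 \<in> U"
  shows "\<exists>N. \<forall>n\<ge>N. Inl n \<in> U"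
proof -
  let ?\<alpha> = "\<omega> \<oplus>o ord_of_nat 2"
  have "generate_topology_on (insert (Field ?\<alpha>) (underS ?\<alpha> ` Field ?\<alpha> \<union> aboveS ?\<alpha> ` Field ?\<alpha>)) U"
    using assms(1) unfolding order_top_def openin_topology_generated_by_iff .
  thus ?thesis using assms(2)
  proof (induction U)
    case Empty
    thus ?case by simp
  next
    case (Int a b)
    then obtain M N where "\<forall>n\<ge>M. Inl n \<in> a" "\<forall>n\<ge>N. Inl n \<in> b" by auto
    thus ?case by (intro exI[of _ "max M N"]) auto
  next
    case (UN K)
    thus ?case by blast
  next
    case (Basis s)
    from Basis(1) consider "s = Field ?\<alpha>"
      | p where "s = underS ?\<alpha> p" | p where "s = aboveS ?\<alpha> p" by blast
    thus ?case
    proof cases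
      case 1
      thus ?thesis by (auto simp: Field_ord_sum Field_natLeq)
    next
      case (2 p)
      thus ?thesis using Basis(2)
        by (cases p) (auto simp: underS_def ord_sum_def Field_natLeq Field_natLeq_on)
    next
      case (3 p)
      \<comment> \<open>A ray above \<open>p\<close> that contains \<open>\<omega>\<close> starts at a natural number.\<close>
      then obtain m where "p = Inl m" using Basis(2)
        by (cases p) (auto simp: aboveS_def ord_sum_def)
      thus ?thesis using 3
        by (intro exI[of _ "Suc m"]) (auto simp: aboveS_def ord_sum_def natLeq_def)
    qed
  qed
qed

definition accumulates_below :: "'a rel \<Rightarrow> 'a set \<Rightarrow> 'a \<Rightarrow> bool"
  where "accumulates_below r X y \<longleftrightarrow>
    X \<inter> underS r y \<noteq> {} \<and> (\<forall>w \<in> underS r y. \<exists>x \<in> X \<inter> underS r y. w \<in> underS r x)"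

text \<open>
  All that is used of a closed copy; unlike the homeomorphism, it moves along embeddings without
  any topology.
\<close>

lemma closed_copy_omega_plus_2_accumulates:
  assumes "Well_order \<beta>" and copy: "closed_copy \<beta> X (\<omega> \<oplus>o ord_of_nat 2)"
  obtains y z where "y \<in> X" "z \<in> X" "y \<in> underS \<beta> z" "accumulates_below \<beta> X y"
proof -
  let ?\<alpha> = "\<omega> \<oplus>o ord_of_nat 2"
  from copy obtain f where X: "X \<subseteq> Field \<beta>" and iso: "iso (Restr \<beta> X) ?\<alpha> f"
    and homeo: "homeomorphic_map (subtopology (order_top \<beta>) X) (order_top ?\<alpha>) f"
    unfolding closed_copy_def by blast
  have field: "Field (Restr \<beta> X) = X"
    using assms(1) X by (simp add: Refl_Field_Restr2 order_on_defs)
  from iso have bij: "bij_betw f X (Field ?\<alpha>)"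
    and mono: "\<And>a b. \<lbrakk>a \<in> X; b \<in> X\<rbrakk> \<Longrightarrow> (a, b) \<in> \<beta> \<longleftrightarrow> (f a, f b) \<in> ?\<alpha>"
    unfolding iso_iff2 field by auto
  have onto: "\<exists>x \<in> X. f x = p" if "p \<in> Field ?\<alpha>" for p
    using bij that unfolding bij_betw_def by (metis imageE)
  obtain y z where y: "y \<in> X" "f y = Inr 0" and z: "z \<in> X" "f z = Inr 1"
    using onto[of "Inr 0"] onto[of "Inr 1"] by (auto simp: Field_ord_sum Field_natLeq_on)
  have below: "x \<in> underS \<beta> y" if "x \<in> X" "f x = Inl n" for x n
    using mono[OF that(1) y(1)] that y
    by (auto simp: underS_def ord_sum_def Field_natLeq Field_natLeq_on)
  have "y \<in> underS \<beta> z"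
    using mono[OF y(1) z(1)] y z by (auto simp: underS_def ord_sum_def)
  moreover have "X \<inter> underS \<beta> y \<noteq> {}"
    using onto[of "Inl 0"] below by (auto simp: Field_ord_sum Field_natLeq)
  moreover have "\<exists>x \<in> X \<inter> underS \<beta> y. w \<in> underS \<beta> x" if "w \<in> underS \<beta> y" for w
  proof -
    from that have w: "(w, y) \<in> \<beta>" "w \<noteq> y" by (auto simp: underS_def)
    have "openin (order_top \<beta>) (aboveS \<beta> w)"
      unfolding order_top_def openin_topology_generated_by_iff
      by (rule generate_topology_on.Basis) (use FieldI1[OF w(1)] in auto)
    hence "openin (subtopology (order_top \<beta>) X) (aboveS \<beta> w \<inter> X)"
      by (auto simp: openin_subtopology)
    hence "openin (order_top ?\<alpha>) (f ` (aboveS \<beta> w \<inter> X))"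
      using homeo homeomorphic_imp_open_map open_map_def by blast
    moreover have "Inr 0 \<in> f ` (aboveS \<beta> w \<inter> X)"
      by (rule image_eqI[of _ _ y]) (use y w in \<open>auto simp: aboveS_def\<close>)
    ultimately obtain n where "Inl n \<in> f ` (aboveS \<beta> w \<inter> X)"
      using open_nhd_of_omega_contains_tail by blast
    then obtain x where "x \<in> X" "x \<in> aboveS \<beta> w" "f x = Inl n" by force
    hence "x \<in> X \<inter> underS \<beta> y" "w \<in> underS \<beta> x"
      using below[of x n] by (auto simp: aboveS_def underS_def)
    thus ?thesis by blast
  qed
  ultimately show ?thesis
    using that y(1) z(1) unfolding accumulates_below_def by blast
qed

lemma accumulates_below_image:
  assumes "embed r r' f" and "X \<subseteq> Field r" and "y \<in> Field r"
    and acc: "accumulates_below r X y" and "Well_order r"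
  shows "accumulates_below r' (f ` X) (f y)"
proof -
  have under: "f ` underS r v = underS r' (f v)" if "v \<in> Field r" for v
    using embed_underS[OF \<open>Well_order r\<close> assms(1) that] by (simp add: bij_betw_def)
  show ?thesis
    unfolding accumulates_below_def
  proof (intro conjI ballI)
    show "f ` X \<inter> underS r' (f y) \<noteq> {}"
      using acc under[OF assms(3)] unfolding accumulates_below_def by blast
    fix w' assume "w' \<in> underS r' (f y)"
    then obtain w where w: "w \<in> underS r y" "w' = f w" using under[OF assms(3)] by blast
    then obtain x where x: "x \<in> X" "x \<in> underS r y" "w \<in> underS r x"
      using acc unfolding accumulates_below_def by blast
    hence "f x \<in> underS r' (f y)" "f w \<in> underS r' (f x)"
      using under assms(2,3) by blast+
    thus "\<exists>x' \<in> f ` X \<inter> underS r' (f y). w' \<in> underS r' x'" using x(1) w(2) by blast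
  qed
qed

text \<open>
  The image of an embedding is downward closed, so reaching the maximum would make it onto. This is
  how a smaller ordinal avoids the top point of \<open>\<omega>\<^sup>2\<cdot>2 + \<omega> + 2\<close>, for which the coloring fails.
\<close>

lemma embedS_misses_maximum:
  assumes r: "Well_order r" and f: "embedS r r' f"
    and max: "Field r' \<subseteq> insert m (underS r' m)" and v: "v \<in> Field r"
  shows "f v \<noteq> m"
proof
  assume m: "f v = m"
  have emb: "embed r r' f" using f unfolding embedS_def by simp
  have "f ` underS r v = underS r' m"
    using embed_underS[OF r emb v] m by (simp add: bij_betw_def)
  moreover have "underS r v \<subseteq> Field r" by (auto simp: underS_def intro: FieldI1)
  ultimately have "underS r' m \<subseteq> f ` Field r" using image_mono by metis
  moreover have "m \<in> f ` Field r" using v m by (rule rev_image_eqI[OF _ sym])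
  ultimately have "Field r' \<subseteq> f ` Field r" using max by (meson insert_subset subset_trans)
  hence "f ` Field r = Field r'" using embed_Field[OF emb] by (rule equalityI[rotated])
  hence "bij_betw f (Field r) (Field r')"
    using embed_inj_on[OF r emb] unfolding bij_betw_def by simp
  thus False using f unfolding embedS_def by simp
qed

section \<open>Colorings by the pentagon\<close>

text \<open>
  The edges of the 5-cycle on \<open>0, \<dots>, 4\<close>, without \<open>mod\<close> so that linear arithmetic applies.
\<close>

definition pentagon_adj :: "nat \<Rightarrow> nat \<Rightarrow> bool"
  where "pentagon_adj i j \<longleftrightarrow> i \<le> 4 \<and> j \<le> 4 \<and> (j = i + 1 \<or> i = j + 1 \<or> j = i + 4 \<or> i = j + 4)"

lemma pentagon_adj_commute: "pentagon_adj i j \<longleftrightarrow> pentagon_adj j i"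
  unfolding pentagon_adj_def by blast

lemma pentagon_triangle_free: "\<not> (pentagon_adj i j \<and> pentagon_adj j k \<and> pentagon_adj i k)"
  unfolding pentagon_adj_def by linarith

definition pentagon_coloring :: "('a \<Rightarrow> nat) \<Rightarrow> 'a set \<Rightarrow> color"
  where "pentagon_coloring g e =
    (if \<exists>x y. e = {x, y} \<and> pentagon_adj (g x) (g y) then Blue else Red)"

lemma pentagon_coloring_pair:
  "pentagon_coloring g {x, y} = (if pentagon_adj (g x) (g y) then Blue else Red)"
proof -
  have "(\<exists>u v. {x, y} = {u, v} \<and> pentagon_adj (g u) (g v)) \<longleftrightarrow> pentagon_adj (g x) (g y)"
    using pentagon_adj_commute unfolding doubleton_eq_iff by blast
  thus ?thesis unfolding pentagon_coloring_def by simp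
qed

lemma pentagon_coloring_no_blue_triangle:
  assumes "Y \<in> [A]\<^bsup>3\<^esup>"
  shows "\<exists>e \<in> [Y]\<^bsup>2\<^esup>. pentagon_coloring g e \<noteq> Blue"
proof (rule ccontr)
  assume "\<not> ?thesis"
  hence blue: "pentagon_coloring g e = Blue" if "e \<in> [Y]\<^bsup>2\<^esup>" for e using that by blast
  from assms have "card Y = 3" by (simp add: nsets_def)
  then obtain a b c where Y: "Y = {a, b, c}" "a \<noteq> b" "b \<noteq> c" "a \<noteq> c"
    by (auto simp: card_3_iff)
  hence "{a, b} \<in> [Y]\<^bsup>2\<^esup>" "{b, c} \<in> [Y]\<^bsup>2\<^esup>" "{a, c} \<in> [Y]\<^bsup>2\<^esup>"
    by (auto simp: nsets_def)
  hence "pentagon_adj (g a) (g b)" "pentagon_adj (g b) (g c)" "pentagon_adj (g a) (g c)"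
    using blue by (fastforce simp: pentagon_coloring_pair split: if_splits)+
  thus False using pentagon_triangle_free by blast
qed

section \<open>The coloring of \<open>\<omega>\<^sup>2\<cdot>2 + \<omega> + 1\<close>\<close>

type_synonym point = "((nat \<times> nat) \<times> nat + nat) + nat"

abbreviation upper_ordinal :: "point rel"
  where "upper_ordinal \<equiv> (\<omega> \<otimes>o \<omega>) \<otimes>o ord_of_nat 2 \<oplus>o \<omega> \<oplus>o ord_of_nat 2"

lemma Well_order_upper_ordinal: "Well_order upper_ordinal"
  by (intro Well_order_ord_sum Well_order_ord_prod natLeq_Well_order natLeq_on_Well_order)

text \<open>
  The triple \<open>((m, n), k)\<close> stands for \<open>\<omega>\<^sup>2\<cdot>k + \<omega>\<cdot>n + m\<close>, so \<open>m = 0\<close> marks the limits and \<open>0\<close>.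
\<close>

fun pentagon_class :: "point \<Rightarrow> nat" where
  "pentagon_class (Inl (Inl ((m, n), k))) =
    (if k = 0 then (if m = 0 \<and> n > 0 then 1 else 0)
     else (if m > 0 then 4 else if n > 0 then 3 else 2))"
| "pentagon_class (Inl (Inr m)) = (if m = 0 then 4 else 3)"
| "pentagon_class (Inr m) = 3"

lemma Field_upper_ordinal_parts:
  "Field ((\<omega> \<otimes>o \<omega>) \<otimes>o ord_of_nat 2) = UNIV \<times> {..<2}"
  "Field ((\<omega> \<otimes>o \<omega>) \<otimes>o ord_of_nat 2 \<oplus>o \<omega>) = Inl ` (UNIV \<times> {..<2}) \<union> range Inr"
  "Field (\<omega> \<otimes>o \<omega>) = UNIV"
proof -
  have "Refl \<omega>" "Refl (ord_of_nat 2)" "Refl (\<omega> \<otimes>o \<omega>)"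
    using natLeq_Well_order natLeq_on_Well_order[of 2]
      Well_order_ord_prod[OF natLeq_Well_order natLeq_Well_order]
    unfolding order_on_defs by auto
  thus "Field (\<omega> \<otimes>o \<omega>) = UNIV" "Field ((\<omega> \<otimes>o \<omega>) \<otimes>o ord_of_nat 2) = UNIV \<times> {..<2}"
    by (auto simp: Field_ord_prod Field_natLeq Field_natLeq_on)
  thus "Field ((\<omega> \<otimes>o \<omega>) \<otimes>o ord_of_nat 2 \<oplus>o \<omega>) = Inl ` (UNIV \<times> {..<2}) \<union> range Inr"
    by (simp add: Field_ord_sum Field_natLeq)
qed

lemma underS_upper_ordinal_simps:
  "Inl (Inl ((m, n), k)) \<in> underS upper_ordinal (Inl (Inl ((m', n'), k'))) \<longleftrightarrow>
    k < 2 \<and> k' < 2 \<and> (k < k' \<or> k = k' \<and> (n < n' \<or> n = n' \<and> m < m'))"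
  "Inl (Inl ((m, n), k)) \<in> underS upper_ordinal (Inl (Inr i)) \<longleftrightarrow> k < 2"
  "Inl (Inl ((m, n), k)) \<in> underS upper_ordinal (Inr j) \<longleftrightarrow> k < 2 \<and> j < 2"
  "Inl (Inr i) \<in> underS upper_ordinal (Inl (Inl ((m, n), k))) \<longleftrightarrow> False"
  "Inl (Inr i) \<in> underS upper_ordinal (Inl (Inr i')) \<longleftrightarrow> i < i'"
  "Inl (Inr i) \<in> underS upper_ordinal (Inr j) \<longleftrightarrow> j < 2"
  "Inr j \<in> underS upper_ordinal (Inl p) \<longleftrightarrow> False"
  "Inr j \<in> underS upper_ordinal (Inr j') \<longleftrightarrow> j < j' \<and> j' < 2"
proof -
  have "(a, b) \<in> \<omega> \<longleftrightarrow> a \<le> b" for a b by (simp add: natLeq_def)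
  note simps = this underS_def ord_sum_iff ord_prod_iff Field_upper_ordinal_parts
    Field_natLeq Field_natLeq_on
  show "Inl (Inl ((m, n), k)) \<in> underS upper_ordinal (Inl (Inl ((m', n'), k'))) \<longleftrightarrow>
    k < 2 \<and> k' < 2 \<and> (k < k' \<or> k = k' \<and> (n < n' \<or> n = n' \<and> m < m'))"
    by (auto simp: simps)
  show "Inl (Inl ((m, n), k)) \<in> underS upper_ordinal (Inl (Inr i)) \<longleftrightarrow> k < 2"
    by (auto simp: simps)
  show "Inl (Inl ((m, n), k)) \<in> underS upper_ordinal (Inr j) \<longleftrightarrow> k < 2 \<and> j < 2"
    by (auto simp: simps)
  show "Inl (Inr i) \<in> underS upper_ordinal (Inl (Inl ((m, n), k))) \<longleftrightarrow> False"
    by (auto simp: simps)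
  show "Inl (Inr i) \<in> underS upper_ordinal (Inl (Inr i')) \<longleftrightarrow> i < i'"
    by (auto simp: simps)
  show "Inl (Inr i) \<in> underS upper_ordinal (Inr j) \<longleftrightarrow> j < 2"
    by (auto simp: simps)
  show "Inr j \<in> underS upper_ordinal (Inl p) \<longleftrightarrow> False"
    by (auto simp: simps)
  show "Inr j \<in> underS upper_ordinal (Inr j') \<longleftrightarrow> j < j' \<and> j' < 2"
    by (auto simp: simps)
qed

text \<open>
  The heart of the matter: no red set accumulates at \<open>y\<close> and is red to a later \<open>z\<close>. The excluded
  \<open>z = Inr 1\<close> is the largest point, the one outside \<open>\<omega>\<^sup>2\<cdot>2 + \<omega> + 1\<close>. With it the claim would fail:
  the points after \<open>\<omega>\<^sup>2\<cdot>2\<close>, including \<open>y = \<omega>\<^sup>2\<cdot>2 + \<omega>\<close> and this \<open>z\<close>, are red to each other.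
\<close>

lemma pentagon_class_hits_accumulation:
  assumes acc: "accumulates_below upper_ordinal X y"
    and yz: "y \<in> underS upper_ordinal z" and z: "z \<noteq> Inr 1"
  shows "pentagon_adj (pentagon_class y) (pentagon_class z) \<or>
    (\<exists>x \<in> X \<inter> underS upper_ordinal y.
      pentagon_adj (pentagon_class x) (pentagon_class y) \<or>
      pentagon_adj (pentagon_class x) (pentagon_class z))"
proof -
  let ?\<gamma> = upper_ordinal
  have between: "\<exists>x \<in> X \<inter> underS ?\<gamma> y. w \<in> underS ?\<gamma> x" if "w \<in> underS ?\<gamma> y" for w
    using acc that unfolding accumulates_below_def by blast
  obtain x0 where x0: "x0 \<in> X" "x0 \<in> underS ?\<gamma> y"
    using acc unfolding accumulates_below_def by blast
  have coords: "\<exists>m n k. x = Inl (Inl ((m, n), k)) \<and> k < 2"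
    if "x \<in> underS ?\<gamma> (Inl (Inl p))" for x p
    using that by (cases p; cases x rule: pentagon_class.cases)
      (auto simp: underS_upper_ordinal_simps)
  consider (fin) m n k where "y = Inl (Inl ((m, n), k))" | (om) i where "y = Inl (Inr i)"
    | (last) j where "y = Inr j"
    by (metis surj_pair sumE)
  thus ?thesis
  proof cases
    case (fin m n k)
    have k: "k < 2"
      using yz fin by (cases z rule: pentagon_class.cases) (auto simp: underS_upper_ordinal_simps)
    consider "m > 0" | "m = 0" "n > 0" | "m = 0" "n = 0" by blast
    thus ?thesis
    proof cases
      case 1
      \<comment> \<open>A successor has nothing strictly between its predecessor and itself.\<close>
      then obtain l where "m = Suc l" by (cases m) auto
      with between[of "Inl (Inl ((l, n), k))"] fin k
      obtain x where x: "x \<in> underS ?\<gamma> y" "Inl (Inl ((l, n), k)) \<in> underS ?\<gamma> x"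
        by (auto simp: underS_upper_ordinal_simps)
      then obtain m' n' k' where "x = Inl (Inl ((m', n'), k'))" using coords fin by blast
      hence False using x fin \<open>m = Suc l\<close> by (auto simp: underS_upper_ordinal_simps)
      thus ?thesis ..
    next
      case 2
      \<comment> \<open>Starting from the previous multiple of \<open>\<omega>\<close>, only successors in one class lie below \<open>y\<close>.\<close>
      then obtain l where l: "n = Suc l" by (cases n) auto
      with between[of "Inl (Inl ((0, l), k))"] fin k 2
      obtain x where x: "x \<in> X" "x \<in> underS ?\<gamma> y" "Inl (Inl ((0, l), k)) \<in> underS ?\<gamma> x"
        by (auto simp: underS_upper_ordinal_simps)
      then obtain m' n' k' where "x = Inl (Inl ((m', n'), k'))" using coords fin by blast
      with x fin l 2 have "x = Inl (Inl ((m', l), k))" "m' > 0"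
        by (auto simp: underS_upper_ordinal_simps)
      hence "pentagon_adj (pentagon_class x) (pentagon_class y)"
        using fin 2 k by (auto simp: pentagon_adj_def)
      thus ?thesis using x by blast
    next
      case 3
      \<comment> \<open>Nothing lies below \<open>0\<close>, so \<open>y\<close> is \<open>\<omega>\<^sup>2\<close>. Any \<open>x\<^sub>0\<close> below is blue to \<open>y\<close> if it is a nonzero
        limit, and otherwise blue to every \<open>z\<close> in class \<open>4\<close>.\<close>
      obtain m' n' k' where x0': "x0 = Inl (Inl ((m', n'), k'))" using x0 coords fin by blast
      hence "k = 1" "k' = 0" using x0 fin 3 k by (auto simp: underS_upper_ordinal_simps)
      hence "pentagon_adj (pentagon_class y) (pentagon_class z) \<or>
        pentagon_adj (pentagon_class x0) (pentagon_class y) \<or>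
        pentagon_adj (pentagon_class x0) (pentagon_class z)"
        using yz fin 3 x0' by (cases z rule: pentagon_class.cases)
          (auto simp: underS_upper_ordinal_simps pentagon_adj_def)
      thus ?thesis using x0 by blast
    qed
  next
    case (om i)
    show ?thesis
    proof (cases i)
      case 0
      \<comment> \<open>Here \<open>y\<close> is \<open>\<omega>\<^sup>2\<cdot>2\<close>, in class \<open>4\<close>, and every later \<open>z\<close> is in class \<open>3\<close>.\<close>
      thus ?thesis using yz om by (cases z rule: pentagon_class.cases)
          (auto simp: underS_upper_ordinal_simps pentagon_adj_def)
    next
      case (Suc l)
      with between[of "Inl (Inr l)"] om obtain x where
        "x \<in> underS ?\<gamma> (Inl (Inr (Suc l)))" "Inl (Inr l) \<in> underS ?\<gamma> x"
        by (auto simp: underS_upper_ordinal_simps)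
      hence False
        by (cases x rule: pentagon_class.cases) (auto simp: underS_upper_ordinal_simps)
      thus ?thesis ..
    qed
  next
    case (last j)
    hence False using yz z by (cases z rule: pentagon_class.cases)
        (auto simp: underS_upper_ordinal_simps)
    thus ?thesis ..
  qed
qed

section \<open>The lower bound\<close>

theorem lemma5p3:
  fixes \<rho> :: "'a rel"
  assumes "is_closed_Ramsey (\<omega> \<oplus>o ord_of_nat 2) 3 \<rho>"
  shows "(\<omega> \<otimes>o \<omega>) \<otimes>o ord_of_nat 2 \<oplus>o \<omega> \<oplus>o ord_of_nat 2 \<le>o \<rho>"
proof (rule ccontr)
  let ?\<gamma> = upper_ordinal
  from assms have \<rho>: "Well_order \<rho>" and arrow: "closed_arrow \<rho> (\<omega> \<oplus>o ord_of_nat 2) 3"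
    unfolding is_closed_Ramsey_def by auto
  assume "\<not> ?\<gamma> \<le>o \<rho>"
  hence "\<rho> <o ?\<gamma>"
    using \<rho> Well_order_upper_ordinal not_ordLeq_iff_ordLess by blast
  then obtain f where f: "embedS \<rho> ?\<gamma> f"
    unfolding ordLess_def by blast
  hence emb: "embed \<rho> ?\<gamma> f" unfolding embedS_def by simp
  have under: "f ` underS \<rho> v = underS ?\<gamma> (f v)" if "v \<in> Field \<rho>" for v
    using embed_underS[OF \<rho> emb that] by (simp add: bij_betw_def)
  have "p = Inr 1 \<or> p \<in> underS ?\<gamma> (Inr 1)" if "p \<in> Field ?\<gamma>" for p
    using that by (cases p rule: pentagon_class.cases) (auto simp: underS_upper_ordinal_simps
        Field_ord_sum[of _ "ord_of_nat 2"] Field_upper_ordinal_parts Field_natLeq_on)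
  hence "Field ?\<gamma> \<subseteq> insert (Inr 1) (underS ?\<gamma> (Inr 1))" by (intro subsetI insertCI) blast
  hence not_max: "f v \<noteq> Inr 1" if "v \<in> Field \<rho>" for v
    using embedS_misses_maximum[OF \<rho> f] that by blast
  let ?c = "pentagon_coloring (\<lambda>v. pentagon_class (f v))"
  have "(\<exists>X. closed_copy \<rho> X (\<omega> \<oplus>o ord_of_nat 2) \<and> (\<forall>e \<in> [X]\<^bsup>2\<^esup>. ?c e = Red)) \<or>
      (\<exists>Y \<in> [Field \<rho>]\<^bsup>3\<^esup>. \<forall>e \<in> [Y]\<^bsup>2\<^esup>. ?c e = Blue)"
    using arrow unfolding closed_arrow_def by (rule spec)
  then obtain X where X: "closed_copy \<rho> X (\<omega> \<oplus>o ord_of_nat 2)"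
    and red: "\<And>e. e \<in> [X]\<^bsup>2\<^esup> \<Longrightarrow> ?c e = Red"
    using pentagon_coloring_no_blue_triangle by blast
  have XF: "X \<subseteq> Field \<rho>" using X unfolding closed_copy_def by blast
  have not_adj: "\<not> pentagon_adj (pentagon_class (f u)) (pentagon_class (f v))"
    if "u \<in> X" "v \<in> X" "u \<noteq> v" for u v
  proof -
    have "{u, v} \<in> [X]\<^bsup>2\<^esup>" using that by (auto simp: nsets_def)
    hence "?c {u, v} = Red" by (rule red)
    thus ?thesis by (simp add: pentagon_coloring_pair split: if_splits)
  qed
  obtain y z where y: "y \<in> X" and z: "z \<in> X" and yz: "y \<in> underS \<rho> z"
    and acc: "accumulates_below \<rho> X y"
    by (rule closed_copy_omega_plus_2_accumulates[OF \<rho> X])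
  have "accumulates_below ?\<gamma> (f ` X) (f y)"
    using accumulates_below_image[OF emb XF _ acc \<rho>] y XF by blast
  moreover have fyz: "f y \<in> underS ?\<gamma> (f z)" using under[of z] yz z XF by blast
  moreover have "f z \<noteq> Inr 1" using not_max z XF by blast
  ultimately consider "pentagon_adj (pentagon_class (f y)) (pentagon_class (f z))"
    | x where "x \<in> X" "f x \<in> underS ?\<gamma> (f y)"
        "pentagon_adj (pentagon_class (f x)) (pentagon_class (f y)) \<or>
         pentagon_adj (pentagon_class (f x)) (pentagon_class (f z))"
    using pentagon_class_hits_accumulation by blast
  thus False
  proof cases
    case 1
    thus False using not_adj[OF y z] yz by (auto simp: underS_def)
  next
    case (2 x)
    moreover have "x \<noteq> y" using 2 by (auto simp: underS_def)
    moreover have "x \<noteq> z"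
      using 2 fyz Well_order_upper_ordinal by (auto simp: underS_def order_on_defs dest: antisymD)
    ultimately show False using not_adj[OF _ y] not_adj[OF _ z] by blast
  qed
qed

end
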